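(* For every integer $k\ge1$, let $$D_k=\sum_{j=1}^{\infty}\left(\log^k\!\left(j+\tfrac12\right)-2\log^k j+\log^k\!\left(j-\tfrac12\right)\right).$$ Then $$\frac{(-1)^k}{2}D_k=-\log^k 2-\zeta^{(k)}(0)+\sum_{j=1}^{k-1}\binom{k}{j}\zeta^{(k-j)}(0)\,\log^j 2 .$$
   Context: $\zeta^{(m)}(0)$ denotes the $m$-th derivative of the (analytically continued) Riemann zeta function at $0$ (written $\zeta^{m}(0)$ in the source). $\log^k x$ means $(\log x)^k$. *)

theory Defs
  imports "HOL-Complex_Analysis.Complex_Analysis"
begin

(* The analytic continuation of the Dirichlet series to the complex plane minus 1. By the identity
   theorem it is determined at every point other than the pole s = 1; the value at 1 is unspecified. *)
definition riemann_zeta :: "complex \<Rightarrow> complex" where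
  "riemann_zeta = (SOME f. f holomorphic_on (- {1}) \<and>
     (\<forall>s. Re s > 1 \<longrightarrow> f s = (\<Sum>n. 1 / of_nat (Suc n) powr s)))"

definition log_diff :: "nat \<Rightarrow> nat \<Rightarrow> real" where
  "log_diff k j = ln (real j + 1/2) ^ k - 2 * ln (real j) ^ k + ln (real j - 1/2) ^ k"

(* The sum over j \<ge> 1, hence the Suc. *)
definition D :: "nat \<Rightarrow> real" where
  "D k = (\<Sum>j. log_diff k (Suc j))"

end

theory Submission
  imports Defs
begin

text \<open>
  For Re s > 1 the odd-even splitting of the zeta series gives
  F(s) = (2^(s+1) - 4) zeta(s) - 2^s, where F(s) is the sum over j of
  (j + 1/2)^(-s) - 2 j^(-s) + (j - 1/2)^(-s). The second differences make this series converge
  locally uniformly for Re s > -1, so the identity persists there, and the k-th derivative of F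
  at 0 is (-1)^k D_k. The Leibniz rule then gives the claim; the value zeta(0) = -1/2 it needs
  comes from F(0) = 0.

  The continuation of zeta itself is obtained half-plane by half-plane: summing the
  binomial expansion of (n + 1)^(1-s) - n^(1-s) over n expresses (s - 1) zeta(s) through
  zeta(s + 1), ..., zeta(s + m) and a remainder series that is holomorphic for Re s > -m.
\<close>

section \<open>Termwise differentiation of series of holomorphic functions\<close>

text \<open>The M-test gives uniform convergence on small closed discs, and locally uniform limits
  of holomorphic functions are holomorphic with convergent derivatives of every order. Intersecting
  the disc with \<open>S\<close> in \<open>bound\<close> spares the user from fitting it into
  \<open>S\<close>.\<close>

lemma holomorphic_series:
  fixes f :: "nat \<Rightarrow> complex \<Rightarrow> complex"
  assumes S: "open S"
    and hol: "\<And>n. f n holomorphic_on S"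
    and bound: "\<And>z. z \<in> S \<Longrightarrow> \<exists>d>0. \<exists>M. summable M \<and> (\<forall>n. \<forall>w \<in> cball z d \<inter> S. norm (f n w) \<le> M n)"
  shows "(\<lambda>z. \<Sum>n. f n z) holomorphic_on S"
    and "z \<in> S \<Longrightarrow> (\<lambda>n. (deriv ^^ k) (f n) z) sums (deriv ^^ k) (\<lambda>z. \<Sum>n. f n z) z"
proof -
  have lim: "\<exists>d>0. cball z d \<subseteq> S \<and>
      uniform_limit (cball z d) (\<lambda>n w. \<Sum>i<n. f i w) (\<lambda>w. \<Sum>i. f i w) sequentially" if z: "z \<in> S" for z
  proof -
    obtain d M where d: "d > 0" "summable M" "\<And>n w. w \<in> cball z d \<inter> S \<Longrightarrow> norm (f n w) \<le> M n"
      using bound[OF z] by blast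
    obtain e where e: "e > 0" "cball z e \<subseteq> S"
      using S z by (meson open_contains_cball)
    show ?thesis
      by (rule exI[of _ "min d e"], intro conjI Weierstrass_m_test)
        (use d e in \<open>auto simp: subset_iff\<close>)
  qed
  show "(\<lambda>z. \<Sum>n. f n z) holomorphic_on S"
    by (rule holomorphic_uniform_sequence[OF S _ lim]) (auto intro!: holomorphic_intros hol)
  assume z: "z \<in> S"
  obtain d where d: "d > 0" "cball z d \<subseteq> S"
      "uniform_limit (cball z d) (\<lambda>n w. \<Sum>i<n. f i w) (\<lambda>w. \<Sum>i. f i w) sequentially"
    using lim[OF z] by blast
  have *: "(deriv ^^ k) (\<lambda>w. \<Sum>i<n. f i w) z = (\<Sum>i<n. (deriv ^^ k) (f i) z)" for n
  proof (induction n)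
    case (Suc n)
    have "(deriv ^^ k) (\<lambda>w. (\<Sum>i<n. f i w) + f n w) z
        = (deriv ^^ k) (\<lambda>w. \<Sum>i<n. f i w) z + (deriv ^^ k) (f n) z"
      by (rule higher_deriv_add[OF _ _ S z]) (auto intro!: holomorphic_intros hol)
    then show ?case using Suc by simp
  qed simp
  have "(\<lambda>n. (deriv ^^ k) (\<lambda>w. \<Sum>i<n. f i w) z) \<longlonglongrightarrow> (deriv ^^ k) (\<lambda>w. \<Sum>i. f i w) z"
  proof (rule higher_deriv_complex_uniform_limit)
    show "uniform_limit (ball z d) (\<lambda>n w. \<Sum>i<n. f i w) (\<lambda>w. \<Sum>i. f i w) sequentially"
      by (rule uniform_limit_on_subset[OF d(3)]) auto
    show "\<forall>\<^sub>F n in sequentially. (\<lambda>w. \<Sum>i<n. f i w) holomorphic_on ball z d"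
      using d(2) by (intro always_eventually allI holomorphic_intros holomorphic_on_subset[OF hol]) auto
  qed (use d in auto)
  then show "(\<lambda>n. (deriv ^^ k) (f n) z) sums (deriv ^^ k) (\<lambda>z. \<Sum>n. f n z) z"
    by (simp add: * sums_def)
qed

section \<open>Binomial expansion with remainder, and series of remainders\<close>

lemma holomorphic_on_gbinomial [holomorphic_intros]:
  "f holomorphic_on S \<Longrightarrow> (\<lambda>z. (f z :: complex) gchoose n) holomorphic_on S"
  unfolding gbinomial_prod_rev by (intro holomorphic_intros) auto

lemma norm_gbinomial_le:
  fixes a :: complex
  shows "norm (a gchoose n) * fact n \<le> (norm a + n) ^ n"
proof -
  have "norm (a gchoose n) * fact n = (\<Prod>i<n. norm (a - of_nat i))"
    by (simp add: gbinomial_prod_rev norm_divide prod_norm lessThan_atLeast0)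
  also have "\<dots> \<le> (\<Prod>i<n. norm a + n)"
  proof (intro prod_mono conjI)
    fix i assume "i \<in> {..<n}"
    then show "norm (a - of_nat i) \<le> norm a + n"
      using norm_triangle_ineq4[of a "of_nat i"] by simp
  qed simp
  finally show ?thesis by simp
qed

text \<open>Taylor's formula at 1 for \<open>u powr a\<close> on the real segment from 1/2 to 2,
  which contains \<open>1 + x\<close> and avoids the branch cut. The point is that \<open>C\<close>
  depends only on \<open>r\<close> and \<open>n\<close>: this uniformity in \<open>a\<close> later
  yields a majorant for the M-test.\<close>

lemma powr_binomial_remainder:
  fixes r :: real and n :: nat
  assumes "r \<ge> 0"
  obtains C where "C \<ge> 0"
    "\<And>(a::complex) x. norm a \<le> r \<Longrightarrow> -1/2 \<le> x \<Longrightarrow> x \<le> 1 \<Longrightarrow>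
       norm (of_real (1 + x) powr a - (\<Sum>i\<le>n. (a gchoose i) * of_real x ^ i)) \<le> C * \<bar>x\<bar> ^ Suc n"
proof
  \<comment> \<open>\<open>B\<close> bounds the Taylor derivative of order \<open>n + 1\<close>: the
    first factor bounds \<open>fact (Suc n) * (a gchoose Suc n)\<close>, the second bounds the
    remaining power of \<open>u\<close>, since \<open>\<bar>ln t\<bar> \<le> ln 2\<close> on the
    segment whatever the sign of the exponent.\<close>
  define B where "B = (r + Suc n) ^ Suc n * 2 powr (r + Suc n)"
  show "B / fact n \<ge> 0" using assms by (simp add: B_def)
  fix a :: complex and x :: real
  assume a: "norm a \<le> r" and x: "-1/2 \<le> x" "x \<le> 1"
  \<comment> \<open>The \<open>i\<close>-th derivative of \<open>u powr a\<close> with respect to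
    \<open>u\<close>.\<close>
  define f where "f = (\<lambda>i u. fact i * (a gchoose i) * u powr (a - of_nat i))"
  let ?S = "complex_of_real ` {1/2..2}"
  have "norm (f 0 (of_real (1 + x)) - (\<Sum>i\<le>n. f i 1 * (of_real (1 + x) - 1) ^ i / fact i))
      \<le> B * norm (of_real (1 + x) - (1::complex)) ^ Suc n / fact n"
  proof (rule complex_Taylor)
    show "convex ?S"
      by (intro convex_linear_image) (auto intro: bounded_linear.linear bounded_linear_of_real)
    show "(f i has_field_derivative f (Suc i) u) (at u within ?S)" if "u \<in> ?S" for i u
    proof -
      have u: "u \<notin> \<real>\<^sub>\<le>\<^sub>0" using that by (auto simp: complex_nonpos_Reals_iff)
      have "(1 + of_nat i) * (a gchoose Suc i) = (a - of_nat i) * (a gchoose i)"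
        using gbinomial_absorb_comp[of a i] gbinomial_mult_1[of a i] by (simp add: algebra_simps)
      then have "fact (Suc i) * (a gchoose Suc i) = fact i * (a gchoose i) * (a - of_nat i)"
        by (simp only: fact_Suc of_nat_Suc) (simp add: mult_ac)
      then have eq: "f (Suc i) u = fact i * (a gchoose i) * ((a - of_nat i) * u powr (a - of_nat i - 1))"
        by (simp only: f_def) (simp add: algebra_simps)
      show ?thesis
        unfolding eq unfolding f_def
        by (intro DERIV_cmult DERIV_subset[OF has_field_derivative_powr[OF u]]) auto
    qed
    show "norm (f (Suc n) u) \<le> B" if u: "u \<in> ?S" for u
    proof -
      obtain t where t: "u = of_real t" "1/2 \<le> t" "t \<le> 2" using u by auto
      define q where "q = Re a - real (Suc n)"
      have q: "\<bar>q\<bar> \<le> r + Suc n" using a abs_Re_le_cmod[of a] by (auto simp: q_def)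
      have "\<bar>ln t\<bar> \<le> ln 2"
        using t ln_le_cancel_iff[of "1/2" t] ln_le_cancel_iff[of t 2] by (auto simp: ln_div abs_le_iff)
      then have "q * ln t \<le> (r + Suc n) * ln 2"
        using mult_mono[OF q, of "\<bar>ln t\<bar>" "ln 2"] assms abs_ge_self[of "q * ln t"] by (auto simp: abs_mult)
      then have "t powr q \<le> 2 powr (r + Suc n)" using t by (simp add: powr_def)
      moreover have "norm (u powr (a - of_nat (Suc n))) = t powr q"
        using t by (simp add: norm_powr_real_powr q_def)
      moreover have "norm (a gchoose Suc n) * fact (Suc n) \<le> (r + Suc n) ^ Suc n"
        by (rule order_trans[OF norm_gbinomial_le power_mono]) (use a in auto)
      ultimately show ?thesis
        unfolding f_def B_def norm_mult norm_fact
        by (intro mult_mono) (use assms in \<open>auto simp: mult.commute\<close>)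
    qed
    show "1 \<in> ?S" by (rule image_eqI[of _ _ 1]) auto
    show "of_real (1 + x) \<in> ?S" using x by (intro imageI) auto
  qed
  then show "norm (of_real (1 + x) powr a - (\<Sum>i\<le>n. (a gchoose i) * of_real x ^ i)) \<le> B / fact n * \<bar>x\<bar> ^ Suc n"
    by (simp add: f_def field_simps)
qed

text \<open>With N = n + 1, this is (N + c)^a minus its binomial expansion in c/N up to order m. It
  has size N^(Re a - m - 1), so the sum over n converges for Re a < m.\<close>

definition binomial_tail :: "real \<Rightarrow> nat \<Rightarrow> nat \<Rightarrow> complex \<Rightarrow> complex" where
  "binomial_tail c m n a = of_real (real (Suc n) + c) powr a
     - (\<Sum>i\<le>m. (a gchoose i) * of_real c ^ i * of_nat (Suc n) powr (a - of_nat i))"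

text \<open>Pure scaling: taking out the factor N^a, with N = n + 1, leaves the binomial remainder
  at c/N, which the first assumption bounds.\<close>

lemma norm_binomial_tail_le:
  assumes C: "norm (of_real (1 + c / Suc n) powr a - (\<Sum>i\<le>m. (a gchoose i) * of_real (c / Suc n) ^ i))
      \<le> C * \<bar>c / Suc n\<bar> ^ Suc m"
    and c: "-1/2 \<le> c" "c \<le> 1" and "C \<ge> 0"
  shows "norm (binomial_tail c m n a) \<le> C * real (Suc n) powr (Re a - Suc m)"
proof -
  define x where "x = real (Suc n)"
  have x: "x \<ge> 1" by (simp add: x_def)
  have pos: "1 + c / x > 0" using c x by (simp add: field_simps)
  have "x + c = x * (1 + c / x)" using x by (simp add: field_simps)
  then have 1: "of_real (x + c) powr a = of_real x powr a * of_real (1 + c / x) powr a"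
    using pos x by (simp only: of_real_mult) (intro powr_times_real, auto)
  have 2: "of_real c ^ i * of_real x powr (a - of_nat i) = of_real x powr a * of_real (c / x) ^ i" for i
    using x by (simp add: powr_diff powr_nat power_divide)
  have 3: "of_nat (Suc n) = complex_of_real x" by (simp add: x_def)
  have "binomial_tail c m n a
      = of_real x powr a * (of_real (1 + c / x) powr a - (\<Sum>i\<le>m. (a gchoose i) * of_real (c / x) ^ i))"
    unfolding binomial_tail_def 3 x_def[symmetric] 1 mult.assoc 2
    by (simp add: right_diff_distrib sum_distrib_left mult_ac)
  then have "norm (binomial_tail c m n a) \<le> x powr Re a * (C * \<bar>c / x\<bar> ^ Suc m)"
    using mult_left_mono[OF C, of "x powr Re a"] x
    by (simp only: norm_mult norm_powr_real_powr x_def[symmetric] Re_complex_of_real Reals_of_real) simp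
  also have "\<dots> \<le> x powr Re a * (C * (1 / x) ^ Suc m)"
    using c x \<open>C \<ge> 0\<close> by (intro mult_left_mono power_mono) (auto simp: divide_simps)
  also have "\<dots> = C * x powr (Re a - Suc m)"
    using x by (simp add: powr_diff powr_realpow power_divide del: power_Suc of_nat_Suc)
  finally show ?thesis by (simp add: x_def)
qed

lemma binomial_tail_series:
  fixes c :: real and m :: nat
  assumes c: "-1/2 \<le> c" "c \<le> 1"
  shows "(\<lambda>a. \<Sum>n. binomial_tail c m n a) holomorphic_on {a. Re a < m}"
    and "Re a < m \<Longrightarrow> (\<lambda>n. (deriv ^^ k) (binomial_tail c m n) a) sums
           (deriv ^^ k) (\<lambda>a. \<Sum>n. binomial_tail c m n a) a"
proof -
  have op: "open {a. Re a < m}" by (rule open_halfspace_Re_lt)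
  have hol: "binomial_tail c m n holomorphic_on {a. Re a < m}" for n
    unfolding binomial_tail_def using c
    by (intro holomorphic_intros)
  have bd: "\<exists>d>0. \<exists>M. summable M \<and>
      (\<forall>n. \<forall>w \<in> cball z d \<inter> {a. Re a < m}. norm (binomial_tail c m n w) \<le> M n)"
    if "z \<in> {a. Re a < m}" for z
  proof -
    \<comment> \<open>Half the distance to the line Re a = m: on the disc of radius \<open>d\<close>
      about \<open>z\<close> the exponent Re w - (m + 1) is at most -1 - d, so one convergent
      majorant serves the whole disc.\<close>
    define d where "d = (m - Re z) / 2"
    have d: "d > 0" using that by (simp add: d_def)
    obtain C where C: "C \<ge> 0"
      "\<And>(a::complex) x. norm a \<le> norm z + d \<Longrightarrow> -1/2 \<le> x \<Longrightarrow> x \<le> 1 \<Longrightarrow>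
         norm (of_real (1 + x) powr a - (\<Sum>i\<le>m. (a gchoose i) * of_real x ^ i)) \<le> C * \<bar>x\<bar> ^ Suc m"
      by (rule powr_binomial_remainder[of "norm z + d" m]) (use d in auto)
    have "summable (\<lambda>n. real (Suc n) powr (- 1 - d))"
      using d summable_real_powr_iff[of "- 1 - d"] by (subst summable_Suc_iff) auto
    moreover have "norm (binomial_tail c m n w) \<le> C * real (Suc n) powr (- 1 - d)"
      if "w \<in> cball z d" for n w
    proof -
      have w: "norm w \<le> norm z + d"
        using that norm_triangle_ineq2[of w z] by (auto simp: dist_norm norm_minus_commute)
      have "\<bar>Re (w - z)\<bar> \<le> d"
        using that abs_Re_le_cmod[of "w - z"] by (auto simp: dist_norm norm_minus_commute)
      then have "Re w \<le> Re z + d" by auto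
      then have re: "Re w - Suc m \<le> - 1 - d" by (simp add: d_def field_simps)
      have x: "-1/2 \<le> c / Suc n" "c / Suc n \<le> 1" using c by (auto simp: field_simps)
      have "norm (binomial_tail c m n w) \<le> C * real (Suc n) powr (Re w - Suc m)"
        by (rule norm_binomial_tail_le[OF C(2)[OF w x] c C(1)])
      also have "\<dots> \<le> C * real (Suc n) powr (- 1 - d)"
        using C re by (intro mult_left_mono powr_mono) auto
      finally show ?thesis .
    qed
    ultimately show ?thesis using d
      by (intro exI[of _ d] conjI exI[of _ "\<lambda>n. C * real (Suc n) powr (- 1 - d)"]) auto
  qed
  show "(\<lambda>a. \<Sum>n. binomial_tail c m n a) holomorphic_on {a. Re a < m}"
    by (rule holomorphic_series(1)[OF op hol bd])
  show "(\<lambda>n. (deriv ^^ k) (binomial_tail c m n) a) sums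
           (deriv ^^ k) (\<lambda>a. \<Sum>n. binomial_tail c m n a) a" if "Re a < m"
    by (rule holomorphic_series(2)[OF op hol bd]) (use that in auto)
qed


lemma holomorphic_on_binomial_tail_series [holomorphic_intros]:
  assumes "f holomorphic_on S" "-1/2 \<le> c" "c \<le> 1" "\<And>s. s \<in> S \<Longrightarrow> Re (f s) < m"
  shows "(\<lambda>s. \<Sum>n. binomial_tail c m n (f s)) holomorphic_on S"
proof -
  have "((\<lambda>a. \<Sum>n. binomial_tail c m n a) \<circ> f) holomorphic_on S"
    by (rule holomorphic_on_compose_gen[OF assms(1) binomial_tail_series(1)[OF assms(2,3)]])
      (use assms(4) in auto)
  then show ?thesis by (simp add: o_def)
qed

section \<open>Analytic continuation of zeta\<close>

definition zeta_series :: "complex \<Rightarrow> complex" where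
  "zeta_series s = (\<Sum>n. 1 / of_nat (Suc n) powr s)"

lemma zeta_series_sums:
  assumes "Re s > 1"
  shows "(\<lambda>n. of_nat (Suc n) powr - s) sums zeta_series s"
proof -
  have "summable (\<lambda>n. real (Suc n) powr - Re s)"
    using assms summable_real_powr_iff[of "- Re s"] by (subst summable_Suc_iff) auto
  then have "summable (\<lambda>n. norm (of_nat (Suc n) powr - s))"
    by (subst norm_powr_real_powr) auto
  then show ?thesis
    using summable_norm_cancel by (auto simp: zeta_series_def powr_minus_divide intro!: summable_sums)
qed

text \<open>The differences (N + 1)^(1-s) - N^(1-s) telescope to -1. In their binomial expansions
  the constant term cancels, the linear one sums to (1 - s) zeta(s), and the one of order j + 1 to a
  multiple of zeta(s + j). The right side is arranged to contain (s - 1) zeta(s) itself, shifted by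
  j, because this pole-free function is the one to be continued.\<close>

lemma zeta_series_recursion:
  assumes s: "Re s > 1"
  shows "(s - 1) * zeta_series s = 1 + (\<Sum>n. binomial_tail 1 (Suc m) n (1 - s))
    - (\<Sum>j=1..m. ((1 - s) gchoose j) / of_nat (Suc j) * ((s + of_nat j - 1) * zeta_series (s + of_nat j)))"
proof -
  define x where "x = (\<lambda>n. of_nat (Suc n) powr (1 - s))"
  have "x \<longlonglongrightarrow> 0"
    unfolding x_def by (rule LIMSEQ_Suc, rule tendsto_neg_powr_complex_of_nat[OF filterlim_ident]) (use s in auto)
  from telescope_sums[OF this] have tele: "(\<lambda>n. x (Suc n) - x n) sums - 1"
    by (simp add: x_def)
  have split: "binomial_tail 1 (Suc m) n (1 - s) = x (Suc n) - x n - (1 - s) * of_nat (Suc n) powr - s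
      - (\<Sum>j=1..m. ((1 - s) gchoose Suc j) * of_nat (Suc n) powr - (s + of_nat j))" for n
  proof -
    define t where "t = (\<lambda>i. ((1 - s) gchoose i) * of_nat (Suc n) powr (1 - s - of_nat i))"
    have "(\<Sum>i\<le>Suc m. t i) = t 0 + (t 1 + (\<Sum>j=1..m. t (Suc j)))"
      by (simp add: sum.atMost_Suc_shift sum.atLeast1_atMost_eq atMost_atLeast0
            sum.atLeast_Suc_atMost sum.shift_bounds_cl_Suc_ivl del: sum.cl_ivl_Suc sum.atMost_Suc)
    moreover have "t 1 = (1 - s) * of_nat (Suc n) powr - s" by (simp add: t_def)
    moreover have "t (Suc j) = ((1 - s) gchoose Suc j) * of_nat (Suc n) powr - (s + of_nat j)" for j
      by (simp add: t_def algebra_simps)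
    moreover have "t 0 = x n" by (simp add: t_def x_def)
    moreover have "binomial_tail 1 (Suc m) n (1 - s) = x (Suc n) - (\<Sum>i\<le>Suc m. t i)"
      by (simp add: binomial_tail_def t_def x_def add_ac del: sum.atMost_Suc)
    ultimately show ?thesis by simp
  qed
  have "(\<lambda>n. binomial_tail 1 (Suc m) n (1 - s)) sums
      (- 1 - (1 - s) * zeta_series s - (\<Sum>j=1..m. ((1 - s) gchoose Suc j) * zeta_series (s + of_nat j)))"
    unfolding split
    by (intro sums_diff tele sums_mult sums_sum zeta_series_sums) (use s in auto)
  then have T: "(\<Sum>n. binomial_tail 1 (Suc m) n (1 - s)) =
      - 1 - (1 - s) * zeta_series s - (\<Sum>j=1..m. ((1 - s) gchoose Suc j) * zeta_series (s + of_nat j))"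
    by (simp only: sums_iff)
  \<comment> \<open>Moves the factor s + j - 1 out of the binomial coefficient, to cancel the pole
    of zeta(s + j).\<close>
  have absorb: "((1 - s) gchoose Suc j) * z
      = - (((1 - s) gchoose j) / of_nat (Suc j) * ((s + of_nat j - 1) * z))" for j z
  proof -
    have "of_nat (Suc j) * ((1 - s) gchoose Suc j) = - (s + of_nat j - 1) * ((1 - s) gchoose j)"
      using gbinomial_absorb_comp[of "1 - s" j] gbinomial_mult_1[of "1 - s" j] by (simp add: algebra_simps)
    then have eq: "(1 - s) gchoose Suc j = - (s + of_nat j - 1) * ((1 - s) gchoose j) / of_nat (Suc j)"
      by (simp add: nonzero_eq_divide_eq mult.commute del: of_nat_Suc)
    have "- c * b / d * z = - (b / d * (c * z))" for b c d :: complex by simp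
    then show ?thesis unfolding eq .
  qed
  show ?thesis
    unfolding T absorb sum_negf by (simp add: left_diff_distrib)
qed

text \<open>The recursion pushes the boundary one unit to the left: for Re s > -(m + 1) the points s
  + j with j >= 1 lie in the previous half-plane, and the tail of order m + 2 at 1 - s converges
  because Re (1 - s) < m + 2.\<close>

lemma halfplane_continuation:
  "\<exists>g. g holomorphic_on {s. Re s > - real m} \<and> (\<forall>s. Re s > 1 \<longrightarrow> g s = (s - 1) * zeta_series s)"
proof (induction m)
  case 0
  show ?case
    using zeta_series_recursion[of _ 0]
    by (intro exI[of _ "\<lambda>s. 1 + (\<Sum>n. binomial_tail 1 (Suc 0) n (1 - s))"])
      (auto intro!: holomorphic_intros)
next
  case (Suc m)
  then obtain g where g: "g holomorphic_on {s. Re s > - real m}"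
      "\<And>s. Re s > 1 \<Longrightarrow> g s = (s - 1) * zeta_series s"
    by blast
  define h where "h = (\<lambda>s. 1 + (\<Sum>n. binomial_tail 1 (Suc (Suc m)) n (1 - s))
    - (\<Sum>j=1..Suc m. ((1 - s) gchoose j) / of_nat (Suc j) * g (s + of_nat j)))"
  have "(\<lambda>s. g (s + of_nat j)) holomorphic_on {s. Re s > - real (Suc m)}" if "j \<in> {1..Suc m}" for j
  proof -
    have "(g \<circ> (\<lambda>s. s + of_nat j)) holomorphic_on {s. Re s > - real (Suc m)}"
      by (rule holomorphic_on_compose_gen[OF _ g(1)]) (use that in \<open>auto intro!: holomorphic_intros\<close>)
    then show ?thesis by (simp add: o_def)
  qed
  then have "h holomorphic_on {s. Re s > - real (Suc m)}"
    unfolding h_def by (intro holomorphic_intros) auto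
  moreover have "h s = (s - 1) * zeta_series s" if "Re s > 1" for s
    using that unfolding h_def
    by (subst zeta_series_recursion[of s "Suc m"]) (auto intro!: sum.cong simp: g(2))
  ultimately show ?case by blast
qed

text \<open>The functions on the half-planes agree on overlaps by the identity theorem, hence glue
  to an entire function.\<close>

lemma entire_continuation:
  obtains G where "G holomorphic_on UNIV" "\<And>s. Re s > 1 \<Longrightarrow> G s = (s - 1) * zeta_series s"
proof -
  obtain g where g: "\<And>m. g m holomorphic_on {s. Re s > - real m}"
      "\<And>m s. Re s > 1 \<Longrightarrow> g m s = (s - 1) * zeta_series s"
    using halfplane_continuation by metis
  have mono: "g m s = g n s" if "m \<le> n" "Re s > - real m" for m n s
  proof (rule analytic_continuation_open[where f = "g m" and g = "g n" and z = s
        and s = "{s. Re s > 1}" and s' = "{s. Re s > - real m}"])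
    show "open {s. Re s > 1}" "open {s. Re s > - real m}"
      by (simp_all add: open_halfspace_Re_gt)
    show "{s. Re s > 1} \<noteq> {}" by (auto intro!: exI[of _ 2])
    show "connected {s. Re s > - real m}"
      by (intro convex_connected convex_halfspace_Re_gt)
    show "g n holomorphic_on {s. Re s > - real m}"
      by (rule holomorphic_on_subset[OF g(1)]) (use that in auto)
  qed (use g that in auto)
  \<comment> \<open>This index makes \<open>s\<close> lie in the half-plane on which the chosen
    function is holomorphic.\<close>
  define G where "G = (\<lambda>s. g (nat \<lceil>- Re s\<rceil> + 1) s)"
  have G: "G s = g m s" if "Re s > - real m" for m s
  proof -
    have "Re s > - real (nat \<lceil>- Re s\<rceil> + 1)" by linarith
    then show ?thesis
      using that mono[of m "nat \<lceil>- Re s\<rceil> + 1" s] mono[of "nat \<lceil>- Re s\<rceil> + 1" m s]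
      unfolding G_def by (cases "m \<le> nat \<lceil>- Re s\<rceil> + 1") auto
  qed
  have "G holomorphic_on (\<Union>m. {s. Re s > - real m})"
  proof (rule holomorphic_on_UN_open)
    fix m
    show "G holomorphic_on {s. Re s > - real m}"
      by (rule holomorphic_transform[OF g(1)]) (simp add: G)
  qed (rule open_halfspace_Re_gt)
  moreover have "s \<in> (\<Union>m. {s. Re s > - real m})" for s
    using reals_Archimedean2[of "- Re s"] by (auto simp: minus_less_iff)
  then have "(\<Union>m. {s. Re s > - real m}) = UNIV" by blast
  ultimately show ?thesis
    using that[of G] G[of 0] g(2)[of _ 0] by auto
qed

text \<open>\<open>riemann_zeta\<close> is a choice, so its defining properties need a witness: the
  entire function divided by s - 1.\<close>

lemma riemann_zeta_props:
  shows holomorphic_riemann_zeta: "riemann_zeta holomorphic_on - {1}"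
    and riemann_zeta_eq_series: "Re s > 1 \<Longrightarrow> riemann_zeta s = zeta_series s"
proof -
  obtain G where G: "G holomorphic_on UNIV" "\<And>s. Re s > 1 \<Longrightarrow> G s = (s - 1) * zeta_series s"
    using entire_continuation by blast
  have "\<exists>f. f holomorphic_on (- {1}) \<and>
     (\<forall>s. Re s > 1 \<longrightarrow> f s = (\<Sum>n. 1 / of_nat (Suc n) powr s))"
  proof (intro exI conjI allI impI)
    show "(\<lambda>s. G s / (s - 1)) holomorphic_on - {1}"
      by (intro holomorphic_intros holomorphic_on_subset[OF G(1)]) auto
    show "G s / (s - 1) = (\<Sum>n. 1 / of_nat (Suc n) powr s)" if "Re s > 1" for s
      using that G(2)[OF that] by (auto simp: zeta_series_def)
  qed
  from someI_ex[OF this, folded riemann_zeta_def]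
  show "riemann_zeta holomorphic_on - {1}" "Re s > 1 \<Longrightarrow> riemann_zeta s = zeta_series s"
    by (auto simp: zeta_series_def)
qed

section \<open>The second-difference series and its relation to zeta\<close>

text \<open>As a function of a = -s; the linear terms of the two tails cancel.\<close>
definition second_diff_series :: "complex \<Rightarrow> complex" where
  "second_diff_series a = (\<Sum>n. binomial_tail (1/2) 1 n a) + (\<Sum>n. binomial_tail (-1/2) 1 n a)"

lemma binomial_tail_half:
  "binomial_tail (1/2) 1 n a + binomial_tail (-1/2) 1 n a =
     of_real (real (Suc n) + 1/2) powr a + of_real (real (Suc n) - 1/2) powr a
       - 2 * of_nat (Suc n) powr a"
  by (simp add: binomial_tail_def algebra_simps)

text \<open>Pairing the terms 2n + 1 = 2(n + 1/2) and 2n + 2 = 2(n + 1) gives zeta(s) = 2^(-s) (H(s)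
  + zeta(s)), where H is the half-integer series; solve for H.\<close>

lemma half_integer_series_sums:
  assumes s: "Re s > 1"
  shows "(\<lambda>n. of_real (real n + 1/2) powr - s) sums ((2 powr s - 1) * zeta_series s)"
proof -
  have mul: "of_real (x * y) powr z = complex_of_real x powr z * of_real y powr z"
    if "x \<ge> 0" "y \<ge> 0" for x y z
    using that by (simp add: powr_times_real)
  have "(\<lambda>n. \<Sum>i\<in>{n * 2..<n * 2 + 2}. of_nat (Suc i) powr - s) sums zeta_series s"
    by (rule sums_group[OF zeta_series_sums[OF s]]) simp
  moreover have "(\<Sum>i\<in>{n * 2..<n * 2 + 2}. of_nat (Suc i) powr - s) =
     2 powr - s * of_real (real n + 1/2) powr - s + 2 powr - s * of_nat (Suc n) powr - s" for n
  proof -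
    have "{n * 2..<n * 2 + 2} = {n * 2, Suc (n * 2)}" by auto
    then show ?thesis
      using mul[of 2 "real n + 1/2" "- s"] mul[of 2 "real (Suc n)" "- s"] by (simp add: algebra_simps)
  qed
  ultimately have "(\<lambda>n. 2 powr - s * of_real (real n + 1/2) powr - s + 2 powr - s * of_nat (Suc n) powr - s)
      sums zeta_series s" by simp
  from sums_mult[OF sums_diff[OF this sums_mult[OF zeta_series_sums[OF s], of "2 powr - s"]], of "2 powr s"]
  have "(\<lambda>n. (2 powr s * 2 powr - s) * of_real (real n + 1/2) powr - s) sums
      (2 powr s * zeta_series s - (2 powr s * 2 powr - s) * zeta_series s)"
    by (simp add: right_diff_distrib mult.assoc)
  moreover have "2 powr s * 2 powr - s = (1::complex)" by (simp flip: powr_add)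
  ultimately show ?thesis by (simp add: left_diff_distrib)
qed

text \<open>Both sides are holomorphic for Re s > -1 away from 1, a connected set, and rearranging
  absolutely convergent series shows that they agree for Re s > 1.\<close>

lemma second_diff_series_eq:
  assumes s: "Re s > -1" "s \<noteq> 1"
  shows "second_diff_series (- s) = (2 * 2 powr s - 4) * riemann_zeta s - 2 powr s"
proof (rule analytic_continuation_open[where f = "\<lambda>s. second_diff_series (- s)"
      and g = "\<lambda>s. (2 * 2 powr s - 4) * riemann_zeta s - 2 powr s"
      and z = s and s = "{s. Re s > 1}" and s' = "{s. Re s > -1} - {1}"])
  show "open {s. Re s > 1}" "open ({s. Re s > -1} - {1})"
    by (auto intro: open_halfspace_Re_gt)
  show "{s. Re s > 1} \<noteq> {}" by (auto intro!: exI[of _ 2])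
  show "connected ({s. Re s > -1} - {1})"
    by (intro connected_open_delete open_halfspace_Re_gt convex_connected convex_halfspace_Re_gt) auto
  show "{s. Re s > 1} \<subseteq> {s. Re s > -1} - {1}" by auto
  show "(\<lambda>s. second_diff_series (- s)) holomorphic_on ({s. Re s > -1} - {1})"
    unfolding second_diff_series_def by (intro holomorphic_intros) auto
  show "(\<lambda>s. (2 * 2 powr s - 4) * riemann_zeta s - 2 powr s) holomorphic_on ({s. Re s > -1} - {1})"
    by (intro holomorphic_intros holomorphic_on_subset[OF holomorphic_riemann_zeta]) auto
  show "second_diff_series (- s) = (2 * 2 powr s - 4) * riemann_zeta s - 2 powr s"
    if "s \<in> {s. Re s > 1}" for s
  proof -
    have s: "Re s > 1" using that by simp
    \<comment> \<open>The termwise differentiation result with derivative order 0.\<close>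
    have tail: "summable (\<lambda>n. binomial_tail c 1 n (- s))" if "-1/2 \<le> c" "c \<le> 1" for c
      using binomial_tail_series(2)[of c "- s" 1 0] that s by (simp add: sums_iff)
    have half: "(1/2) powr - s = 2 powr s"
      using Ln_inverse[of 2] by (simp add: powr_def)
    \<comment> \<open>This half-integer series starts at 3/2, so its missing first term (1/2)^(-s) =
      2^s is subtracted; the next one starts at 1/2 and is complete.\<close>
    have "(\<lambda>n. of_real (real (Suc n) + 1/2) powr - s) sums ((2 powr s - 1) * zeta_series s - 2 powr s)"
      using half_integer_series_sums[OF s] half by (subst sums_Suc_iff) simp
    moreover have "(\<lambda>n. of_real (real (Suc n) - 1/2) powr - s) sums ((2 powr s - 1) * zeta_series s)"
      using half_integer_series_sums[OF s] by (simp add: algebra_simps)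
    ultimately have "(\<lambda>n. binomial_tail (1/2) 1 n (- s) + binomial_tail (-1/2) 1 n (- s)) sums
        ((2 powr s - 1) * zeta_series s - 2 powr s + (2 powr s - 1) * zeta_series s - 2 * zeta_series s)"
      unfolding binomial_tail_half by (intro sums_diff sums_add sums_mult zeta_series_sums s)
    moreover have "(\<lambda>n. binomial_tail (1/2) 1 n (- s) + binomial_tail (-1/2) 1 n (- s)) sums
        second_diff_series (- s)"
      unfolding second_diff_series_def by (intro sums_add summable_sums tail) auto
    ultimately have "second_diff_series (- s)
        = (2 powr s - 1) * zeta_series s - 2 powr s + (2 powr s - 1) * zeta_series s - 2 * zeta_series s"
      using sums_unique2 by blast
    then show ?thesis by (simp add: riemann_zeta_eq_series s algebra_simps)
  qed
qed (use s in auto)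

section \<open>Derivatives at 0\<close>

lemma higher_deriv_powr_right:
  fixes w :: complex
  assumes "w \<noteq> 0"
  shows "(deriv ^^ k) (\<lambda>a. w powr a) = (\<lambda>a. Ln w ^ k * w powr a)"
proof (induction k)
  case (Suc k)
  have "deriv (\<lambda>a. Ln w ^ k * w powr a) a = Ln w ^ Suc k * w powr a" for a
    by (rule DERIV_imp_deriv) (use assms in \<open>auto intro!: derivative_eq_intros\<close>)
  with Suc show ?case by auto
qed simp

text \<open>Termwise differentiation at a = 0, where the k-th derivative of w^a is (Ln w)^k. No sign
  appears because the variable is a = -s.\<close>

lemma log_diff_sums:
  "(\<lambda>n. complex_of_real (log_diff k (Suc n))) sums (deriv ^^ k) second_diff_series 0"
proof -
  define S where "S = {a. Re a < real 1}"
  have S: "open S" "0 \<in> S" by (auto simp: S_def open_halfspace_Re_lt)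
  have hol: "binomial_tail c 1 n holomorphic_on S" for c n
    unfolding binomial_tail_def by (intro holomorphic_intros)
  have "(deriv ^^ k) (binomial_tail (1/2) 1 n) 0 + (deriv ^^ k) (binomial_tail (-1/2) 1 n) 0
      = complex_of_real (log_diff k (Suc n))" for n
  proof -
    define p q x where "p = complex_of_real (real (Suc n) + 1/2)"
      and "q = complex_of_real (real (Suc n) - 1/2)" and "x = complex_of_real (real (Suc n))"
    have nz: "p \<noteq> 0" "q \<noteq> 0" "x \<noteq> 0"
      unfolding p_def q_def x_def of_real_eq_0_iff by auto
    have "(deriv ^^ k) (binomial_tail (1/2) 1 n) 0 + (deriv ^^ k) (binomial_tail (-1/2) 1 n) 0
        = (deriv ^^ k) (\<lambda>a. binomial_tail (1/2) 1 n a + binomial_tail (-1/2) 1 n a) 0"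
      by (rule higher_deriv_add[symmetric, OF hol hol S])
    also have "(\<lambda>a. binomial_tail (1/2) 1 n a + binomial_tail (-1/2) 1 n a)
        = (\<lambda>a. p powr a + q powr a - 2 * x powr a)"
      unfolding binomial_tail_half p_def q_def x_def by simp
    also have "(deriv ^^ k) \<dots> 0
        = (deriv ^^ k) (\<lambda>a. p powr a + q powr a) 0 - (deriv ^^ k) (\<lambda>a. 2 * x powr a) 0"
      by (rule higher_deriv_diff[OF _ _ S]) (intro holomorphic_intros)+
    also have "(deriv ^^ k) (\<lambda>a. p powr a + q powr a) 0
        = (deriv ^^ k) (\<lambda>a. p powr a) 0 + (deriv ^^ k) (\<lambda>a. q powr a) 0"
      by (rule higher_deriv_add[OF _ _ S]) (intro holomorphic_intros)+
    also have "(deriv ^^ k) (\<lambda>a. 2 * x powr a) 0 = 2 * (deriv ^^ k) (\<lambda>a. x powr a) 0"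
      by (rule higher_deriv_cmult[OF _ S(2,1)]) (intro holomorphic_intros)
    also have "(deriv ^^ k) (\<lambda>a. p powr a) 0 + (deriv ^^ k) (\<lambda>a. q powr a) 0
        - 2 * (deriv ^^ k) (\<lambda>a. x powr a) 0 = Ln p ^ k + Ln q ^ k - 2 * Ln x ^ k"
      using nz by (simp add: higher_deriv_powr_right)
    also have "\<dots> = complex_of_real (log_diff k (Suc n))"
      unfolding p_def q_def x_def log_diff_def
      \<comment> \<open>All three arguments are positive, the smallest possible one being 1/2, so
        \<open>Ln\<close> is the real logarithm.\<close>
      by (subst (1 2 3) Ln_of_real) auto
    finally show ?thesis .
  qed
  moreover have "(deriv ^^ k) second_diff_series 0
      = (deriv ^^ k) (\<lambda>a. \<Sum>n. binomial_tail (1/2) 1 n a) 0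
        + (deriv ^^ k) (\<lambda>a. \<Sum>n. binomial_tail (-1/2) 1 n a) 0"
    unfolding second_diff_series_def[abs_def]
    by (rule higher_deriv_add[OF _ _ S]) (auto simp: S_def intro!: holomorphic_intros)
  moreover have "(\<lambda>n. (deriv ^^ k) (binomial_tail (1/2) 1 n) 0 + (deriv ^^ k) (binomial_tail (-1/2) 1 n) 0) sums
      ((deriv ^^ k) (\<lambda>a. \<Sum>n. binomial_tail (1/2) 1 n a) 0
        + (deriv ^^ k) (\<lambda>a. \<Sum>n. binomial_tail (-1/2) 1 n a) 0)"
    by (intro sums_add binomial_tail_series(2)) auto
  ultimately show ?thesis by simp
qed

lemma riemann_zeta_0: "riemann_zeta 0 = - 1/2"
proof -
  \<comment> \<open>The bound on \<open>c\<close> keeps the base n + 1 + c nonzero, which matters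
    since \<open>0 powr 0 = 0\<close>. The tail is then 1 - 1.\<close>
  have "binomial_tail c 1 n 0 = 0" if "\<bar>c\<bar> < 1" for c n
    using that by (simp add: binomial_tail_def complex_eq_iff)
  then have "second_diff_series 0 = 0" by (simp add: second_diff_series_def)
  then have "- 2 * riemann_zeta 0 - 1 = 0" using second_diff_series_eq[of 0] by simp
  moreover have "riemann_zeta 0 = - 1/2 - (- 2 * riemann_zeta 0 - 1) / 2" by (simp add: field_simps)
  ultimately show ?thesis by simp
qed

section \<open>The Leibniz rule at 0\<close>

theorem proposition4:
  fixes k :: nat
  assumes "k \<ge> 1"
  shows "summable (\<lambda>j. log_diff k (Suc j)) \<and>
    (- 1) ^ k / 2 * complex_of_real (D k) =
      - complex_of_real (ln 2 ^ k) - (deriv ^^ k) riemann_zeta 0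
      + (\<Sum>j = 1..<k. of_nat (k choose j) * (deriv ^^ (k - j)) riemann_zeta 0
                        * complex_of_real (ln 2 ^ j))"
proof -
  define K where "K = (\<lambda>s. (2 * 2 powr s - 4) * riemann_zeta s - 2 powr s)"
  \<comment> \<open>The unit disc avoids the pole at 1, is stable under a -> -a, and lies in Re s >
    -1.\<close>
  define S :: "complex set" where "S = ball 0 1"
  have S: "open S" "0 \<in> S" by (auto simp: S_def)
  have zeta: "riemann_zeta holomorphic_on S"
    by (rule holomorphic_on_subset[OF holomorphic_riemann_zeta]) (auto simp: S_def)
  have A: "(\<lambda>s. 2 * 2 powr s - 4 :: complex) holomorphic_on S"
    by (intro holomorphic_intros)
  have K: "K holomorphic_on S"
    unfolding K_def by (intro holomorphic_intros zeta)
  have Ln2: "Ln 2 = complex_of_real (ln 2)"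
    using Ln_of_real[of 2] by simp
  have sums: "(\<lambda>n. complex_of_real (log_diff k (Suc n))) sums (deriv ^^ k) second_diff_series 0"
    by (rule log_diff_sums)
  have summable: "summable (\<lambda>n. log_diff k (Suc n))"
    using sums summable_of_real_iff[where ?'a = complex] by (auto simp: sums_iff)
  have "complex_of_real (D k) = (deriv ^^ k) second_diff_series 0"
    using sums_unique2[OF sums_of_real[OF summable_sums[OF summable]] sums] by (simp add: D_def)
  \<comment> \<open>The substitution a = -s is written as a product to match the chain rule for
    linear maps, which then supplies the factor (-1)^k.\<close>
  also have "\<dots> = (deriv ^^ k) (\<lambda>a. K (- 1 * a)) 0"
  proof (rule higher_deriv_cong_ev)
    have "\<forall>\<^sub>F a in nhds 0. a \<in> S" by (rule eventually_nhds_in_open[OF S])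
    then show "\<forall>\<^sub>F a in nhds 0. second_diff_series a = K (- 1 * a)"
    proof eventually_elim
      case (elim a)
      have "Re (- a) > -1" using elim abs_Re_le_cmod[of a] by (auto simp: S_def)
      moreover have "- a \<noteq> 1" using elim by (auto simp: S_def minus_equation_iff)
      ultimately show ?case using second_diff_series_eq[of "- a"] by (simp add: K_def)
    qed
  qed simp
  also have "\<dots> = (- 1) ^ k * (deriv ^^ k) K (- 1 * 0)"
    by (rule higher_deriv_compose_linear[OF K S(1) S(1) S(2)]) (auto simp: S_def)
  finally have D: "complex_of_real (D k) = (- 1) ^ k * (deriv ^^ k) K 0" by simp
  \<comment> \<open>The constant 4 contributes only at j = 0, where the value is -2.\<close>
  have dA: "(deriv ^^ j) (\<lambda>s. 2 * 2 powr s - 4 :: complex) 0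
      = 2 * of_real (ln 2) ^ j - (if j = 0 then 4 else 0)" for j
  proof -
    have "(deriv ^^ j) (\<lambda>s. 2 * 2 powr s - 4 :: complex) 0
        = (deriv ^^ j) (\<lambda>s. 2 * 2 powr s :: complex) 0 - (deriv ^^ j) (\<lambda>s. 4 :: complex) 0"
      by (rule higher_deriv_diff[OF _ _ S]) (intro holomorphic_intros)+
    also have "(deriv ^^ j) (\<lambda>s. 2 * 2 powr s :: complex) 0 = 2 * (deriv ^^ j) (\<lambda>s. 2 powr s) 0"
      by (rule higher_deriv_cmult[OF _ S(2,1)]) (intro holomorphic_intros)
    finally show ?thesis by (simp add: higher_deriv_powr_right Ln2)
  qed
  have "(deriv ^^ k) K 0 = (deriv ^^ k) (\<lambda>s. (2 * 2 powr s - 4) * riemann_zeta s) 0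
      - (deriv ^^ k) (\<lambda>s. 2 powr s) 0"
    unfolding K_def by (rule higher_deriv_diff[OF _ _ S]) (intro holomorphic_intros zeta)+
  also have "\<dots> = (\<Sum>j=0..k. of_nat (k choose j) * (deriv ^^ j) (\<lambda>s. 2 * 2 powr s - 4) 0
      * (deriv ^^ (k - j)) riemann_zeta 0) - of_real (ln 2) ^ k"
    by (subst higher_deriv_mult[OF A zeta S]) (simp add: higher_deriv_powr_right Ln2)
  \<comment> \<open>The term j = 0 gives -2 times the k-th derivative of zeta. The term j = k gives
    2 log^k 2 zeta(0) = -log^k 2, which joins the -log^k 2 coming from -2^s. Since k >= 1, these two
    terms are distinct.\<close>
  also have "{0..k} = insert 0 (insert k {1..<k})" using assms by auto
  finally have "(deriv ^^ k) K 0 = - 2 * of_real (ln 2) ^ k - 2 * (deriv ^^ k) riemann_zeta 0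
      + 2 * (\<Sum>j = 1..<k. of_nat (k choose j) * (deriv ^^ (k - j)) riemann_zeta 0 * complex_of_real (ln 2 ^ j))"
    using assms by (simp add: dA riemann_zeta_0 sum_distrib_left mult_ac)
  moreover have "(- 1) ^ k / 2 * complex_of_real (D k) = (deriv ^^ k) K 0 / 2"
    unfolding D by (simp flip: power_mult_distrib mult.assoc)
  ultimately show ?thesis using summable by simp
qed

end
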